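(* Let $G$ be a finite, connected, simple undirected graph with vertices $v_0,\dots,v_n$ and edge set $E$. For a $G$-semiorientation $\mathcal{O}$, let $\rho(\mathcal{O})\subseteq\mathbb{R}^{n+1}$ be the set of points $x=(x_0,\dots,x_n)$ satisfying, for every edge $e=\{v_i,v_j\}\in E$: $x_j>x_i+1$ if $(v_i,v_j)\in\mathcal{O}$, and $|x_i-x_j|<1$ if $e$ is blank in $\mathcal{O}$. Then for every $G$-semiorientation $\mathcal{O}$, $\rho(\mathcal{O})$ is a region of the $G$-semiorder arrangement (in particular it is nonempty), and the map $\rho$ from the set of $G$-semiorientations to the set of regions of the $G$-semiorder arrangement is a bijection.
   Context: A partial orientation of $G$ is a subset $\mathcal{O}\subseteq V\times V$ ($V$ the vertex set) such that if $(u,v)\in\mathcal{O}$ then $\{u,v\}\in E$ and $(v,u)\notin\mathcal{O}$; edges $\{u,v\}$ with neither $(u,v)$ nor $(v,u)$ in $\mathcal{O}$ are blank, the others oriented. A cycle $C$ of $G$ is a potential cycle for $\mathcal{O}$ if the blank edges of $C$ can be directed so that $C$ becomes a directed cycle. A $G$-semiorientation is a partial orientation such that every potential cycle has strictly more blank edges than oriented edges. The $G$-semiorder arrangement is the set of $2|E|$ hyperplanes $x_i-x_j=1$ in $\mathbb{R}^{n+1}$, for all ordered pairs $i\neq j$ with $\{v_i,v_j\}\in E$; its regions are the connected components of the complement in $\mathbb{R}^{n+1}$ of the union of these hyperplanes. *)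

theory Defs
  imports "HOL-Analysis.Analysis"
begin

text \<open>
  The vertex set of the graph is a finite type \<open>'v\<close>, which also indexes the coordinates, so the
  ambient space is \<open>real ^ 'v\<close>, with \<open>CARD('v)\<close> in the role of $n+1$.  An undirected graph is given
  by its set of edges, each edge being an unordered pair of vertices.
\<close>

definition simple_graph :: "'v set set \<Rightarrow> bool" where
  "simple_graph E \<longleftrightarrow> (\<forall>e\<in>E. card e = 2)"

definition connected_graph :: "'v set set \<Rightarrow> bool" where
  "connected_graph E \<longleftrightarrow> (\<forall>u v. (u, v) \<in> {(a, b). {a, b} \<in> E}\<^sup>*)"

definition partial_orientation :: "'v set set \<Rightarrow> ('v \<times> 'v) set \<Rightarrow> bool" where
  "partial_orientation E \<O> \<longleftrightarrow> (\<forall>u v. (u, v) \<in> \<O> \<longrightarrow> {u, v} \<in> E \<and> (v, u) \<notin> \<O>)"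

definition oriented_edges :: "'v set set \<Rightarrow> ('v \<times> 'v) set \<Rightarrow> 'v set set" where
  "oriented_edges E \<O> = {e \<in> E. \<exists>u v. e = {u, v} \<and> (u, v) \<in> \<O>}"

definition blank_edges :: "'v set set \<Rightarrow> ('v \<times> 'v) set \<Rightarrow> 'v set set" where
  "blank_edges E \<O> = E - oriented_edges E \<O>"

text \<open>
  A cycle is represented by the list of its vertices in one of its cyclic orders, without
  repeating the start vertex at the end.
\<close>

definition cycle_arcs :: "'v list \<Rightarrow> ('v \<times> 'v) set" where
  "cycle_arcs c = {(c ! i, c ! (Suc i mod length c)) | i. i < length c}"

definition cycle_edges :: "'v list \<Rightarrow> 'v set set" where
  "cycle_edges c = {{u, v} | u v. (u, v) \<in> cycle_arcs c}"

definition is_cycle :: "'v set set \<Rightarrow> 'v list \<Rightarrow> bool" where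
  "is_cycle E c \<longleftrightarrow> length c \<ge> 3 \<and> distinct c \<and> cycle_edges c \<subseteq> E"

text \<open>\<open>directs F D\<close>: the set of arcs \<open>D\<close> consists of exactly one direction for each edge in \<open>F\<close>.\<close>

definition directs :: "'v set set \<Rightarrow> ('v \<times> 'v) set \<Rightarrow> bool" where
  "directs F D \<longleftrightarrow> (\<forall>u v. (u, v) \<in> D \<longrightarrow> {u, v} \<in> F) \<and>
     (\<forall>u v. {u, v} \<in> F \<longrightarrow> ((u, v) \<in> D \<longleftrightarrow> (v, u) \<notin> D))"

text \<open>The resulting directed cycle may run through \<open>c\<close> in either of its two senses.\<close>

definition potential_cycle :: "'v set set \<Rightarrow> ('v \<times> 'v) set \<Rightarrow> 'v list \<Rightarrow> bool" where
  "potential_cycle E \<O> c \<longleftrightarrow> is_cycle E c \<and>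
     (\<exists>D. directs (cycle_edges c \<inter> blank_edges E \<O>) D \<and>
        {(u, v) \<in> \<O>. {u, v} \<in> cycle_edges c} \<union> D \<in> {cycle_arcs c, cycle_arcs (rev c)})"

definition semiorientation :: "'v set set \<Rightarrow> ('v \<times> 'v) set \<Rightarrow> bool" where
  "semiorientation E \<O> \<longleftrightarrow> partial_orientation E \<O> \<and>
     (\<forall>c. potential_cycle E \<O> c \<longrightarrow>
        card (cycle_edges c \<inter> blank_edges E \<O>) > card (cycle_edges c \<inter> oriented_edges E \<O>))"

definition semiorder_arrangement :: "'v set set \<Rightarrow> (real ^ 'v) set set" where
  "semiorder_arrangement E = {{x. x $ i - x $ j = 1} | i j. i \<noteq> j \<and> {i, j} \<in> E}"

definition regions :: "(real ^ 'v) set set \<Rightarrow> (real ^ 'v::finite) set set" where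
  "regions \<A> = components (UNIV - \<Union>\<A>)"

definition rho :: "'v set set \<Rightarrow> ('v \<times> 'v) set \<Rightarrow> (real ^ 'v) set" where
  "rho E \<O> = {x. \<forall>i j. {i, j} \<in> E \<longrightarrow>
     ((i, j) \<in> \<O> \<longrightarrow> x $ j > x $ i + 1) \<and>
     ({i, j} \<in> blank_edges E \<O> \<longrightarrow> \<bar>x $ i - x $ j\<bar> < 1)}"

end

theory Submission
  imports Defs
begin

text \<open>
  A point of \<open>rho E \<O>\<close> is a solution of a system of strict difference constraints
  \<open>x u - x v < w (u, v)\<close>, one for every arc that is oriented (\<open>w = -1\<close>) or is a direction of a blank
  edge (\<open>w = 1\<close>).  Such a system is solvable iff every directed cycle has positive weight, and for
  cycles of length at least 3 this is precisely the condition on potential cycles.  The sets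
  \<open>rho E \<O>\<close> are convex, every point off the hyperplanes lies in exactly one of them, and the signs
  of \<open>x i - x j - 1\<close> are constant on a region; so they are the regions.
\<close>

section \<open>Strict difference constraints\<close>

definition walk_weight :: "('v \<times> 'v \<Rightarrow> 'a::monoid_add) \<Rightarrow> 'v list \<Rightarrow> 'a" where
  "walk_weight w p = sum_list (map w (zip p (tl p)))"

text \<open>Pairing with \<open>rotate1\<close> includes the arc from the last vertex to the first.
  Hence \<open>[u]\<close> stands for a loop and \<open>[u, v]\<close> for an arc followed by its
  reverse.\<close>

definition cycle_weight :: "('v \<times> 'v \<Rightarrow> 'a::monoid_add) \<Rightarrow> 'v list \<Rightarrow> 'a" where
  "cycle_weight w c = sum_list (map w (zip c (rotate1 c)))"

text \<open>Cuts the arcs of a walk at a visit to \<open>i\<close>, which ends the first piece and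
  starts the second.\<close>

lemma zip_tl_append_Cons:
  "zip (ys @ i # zs) (tl (ys @ i # zs)) = zip (ys @ [i]) (tl (ys @ [i])) @ zip (i # zs) zs"
proof (induction ys)
  case (Cons a ys)
  then show ?case by (cases ys) auto
qed simp

lemma zip_rotate1_append_single:
  "zip (ys @ [i]) (rotate1 (ys @ [i])) = zip (ys @ [i]) (tl (ys @ [i])) @ [(i, hd (ys @ [i]))]"
proof (cases ys)
  case (Cons a as)
  have "zip (a # as @ [i]) (as @ [i] @ [a]) = zip (a # as @ [i]) (as @ [i]) @ [(i, a)]"
    using zip_append[of "a # as" "as @ [i]" "[i]" "[a]"] zip_append[of "a # as" "as @ [i]" "[i]" "[]"]
    by simp
  then show ?thesis using Cons by simp
qed simp

lemma cycle_arcs_eq: "cycle_arcs c = set (zip c (rotate1 c))"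
  by (auto simp: cycle_arcs_def set_zip nth_rotate1)

lemma finite_distinct_lists: "finite {p :: 'v::finite list. distinct p \<and> P p}"
proof -
  have "{p :: 'v list. distinct p \<and> P p} \<subseteq> {p. set p \<subseteq> UNIV \<and> distinct p}"
    by auto
  then show ?thesis
    by (rule finite_subset) (rule finite_subset_distinct[OF finite])
qed

text \<open>Shortest-path potential: \<open>x v\<close> is the least weight of a simple path
  starting at \<open>v\<close>. Prepending \<open>u\<close> to an optimal path from \<open>v\<close>
  gives the constraint for \<open>(u, v)\<close>, unless the path already visits \<open>u\<close>;
  then a cycle of nonnegative weight is cut off.\<close>

lemma difference_constraints_solvable:
  fixes w :: "'v::finite \<times> 'v \<Rightarrow> real"
  assumes nonneg: "\<And>c. distinct c \<Longrightarrow> cycle_arcs c \<subseteq> A \<Longrightarrow> cycle_weight w c \<ge> 0"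
  shows "\<exists>x. \<forall>(u, v)\<in>A. x u \<le> w (u, v) + x v"
proof -
  \<comment> \<open>The end point is free, so \<open>[v]\<close> always belongs to
    \<open>P v\<close> and no root vertex has to be fixed.\<close>
  define P where "P v = {p. distinct p \<and> (p \<noteq> [] \<and> hd p = v \<and> set (zip p (tl p)) \<subseteq> A)}" for v
  define x where "x v = Min (walk_weight w ` P v)" for v
  have fin: "finite (P v)" for v
    unfolding P_def by (rule finite_distinct_lists)
  have "[v] \<in> P v" for v by (simp add: P_def)
  then have ne: "P v \<noteq> {}" for v by blast
  have le: "x v \<le> walk_weight w p" if "p \<in> P v" for p v
    unfolding x_def using fin that by (intro Min_le) auto
  have "x u \<le> w (u, v) + x v" if uv: "(u, v) \<in> A" for u v
  proof -
    have "x v \<in> walk_weight w ` P v"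
      unfolding x_def using fin ne by (intro Min_in) auto
    then obtain p where p: "p \<in> P v" "x v = walk_weight w p" by auto
    obtain p' where p': "p = v # p'" using p(1) by (cases p) (auto simp: P_def)
    show ?thesis
    proof (cases "u \<in> set p")
      case False
      then have "u # p \<in> P u" using p(1) uv p' by (auto simp: P_def)
      from le[OF this] show ?thesis using p p' by (simp add: walk_weight_def)
    next
      case True
      then obtain ys zs where yz: "p = ys @ u # zs" by (auto simp: in_set_conv_decomp)
      \<comment> \<open>The part of \<open>p\<close> up to \<open>u\<close>, closed by the arc
        \<open>(u, v)\<close>, is a simple cycle. Since its weight is nonnegative, the rest
        \<open>u # zs\<close> weighs at most \<open>w (u, v)\<close> plus the weight of
        \<open>p\<close>.\<close>
      define c where "c = ys @ [u]"
      have hd: "hd c = v" using p' yz unfolding c_def by (cases ys) auto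
      have split: "zip p (tl p) = zip c (tl c) @ zip (u # zs) zs"
        unfolding yz c_def by (rule zip_tl_append_Cons)
      have rot: "zip c (rotate1 c) = zip c (tl c) @ [(u, v)]"
        using zip_rotate1_append_single[of ys u] hd by (simp add: c_def)
      have "u # zs \<in> P u" "distinct c" "cycle_arcs c \<subseteq> A"
        using p(1) split rot uv yz by (auto simp: P_def cycle_arcs_eq c_def)
      then have "x u \<le> walk_weight w (u # zs)" "cycle_weight w c \<ge> 0"
        using le nonneg by auto
      then show ?thesis
        using p(2) split rot by (simp add: walk_weight_def cycle_weight_def)
    qed
  qed
  then show ?thesis by blast
qed

lemma sum_list_map_minus_const:
  "sum_list (map (\<lambda>a. w a - e) xs) = sum_list (map w xs) - real (length xs) * e"
  by (induction xs) (auto simp: algebra_simps)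

text \<open>There are only finitely many simple cycles, so their weights are bounded away from 0.
  This leaves room to lower every weight slightly and solve the weak system.\<close>

lemma strict_difference_constraints_solvable:
  fixes w :: "'v::finite \<times> 'v \<Rightarrow> real"
  assumes pos: "\<And>c. c \<noteq> [] \<Longrightarrow> distinct c \<Longrightarrow> cycle_arcs c \<subseteq> A \<Longrightarrow> cycle_weight w c > 0"
  shows "\<exists>x. \<forall>(u, v)\<in>A. x u < w (u, v) + x v"
proof -
  define W where "W = cycle_weight w ` {c. distinct c \<and> (c \<noteq> [] \<and> cycle_arcs c \<subseteq> A)}"
  have finW: "finite W" unfolding W_def by (intro finite_imageI finite_distinct_lists)
  \<comment> \<open>Inserting 1 keeps the minimum defined and positive when there is no cycle at
    all.\<close>
  define d where "d = Min (insert 1 W)"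
  have d_pos: "d > 0" unfolding d_def using finW pos by (auto simp: W_def)
  \<comment> \<open>A simple cycle has at most \<open>CARD('v)\<close> arcs, so lowering all weights by \<open>e\<close> keeps it nonnegative.\<close>
  define e where "e = d / CARD('v)"
  have e_pos: "e > 0" using d_pos by (simp add: e_def)
  have "cycle_weight (\<lambda>a. w a - e) c \<ge> 0" if c: "distinct c" "cycle_arcs c \<subseteq> A" for c
  proof (cases "c = []")
    case True
    then show ?thesis by (simp add: cycle_weight_def)
  next
    case False
    have "length c \<le> CARD('v)"
      using c(1) by (metis card_mono distinct_card finite_class.finite_UNIV subset_UNIV)
    then have "real (length c) * e \<le> CARD('v) * e" using e_pos by simp
    also have "\<dots> = d" by (simp add: e_def)
    also have "d \<le> cycle_weight w c"
      unfolding d_def using finW False c by (intro Min_le) (auto simp: W_def)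
    finally show ?thesis by (simp add: cycle_weight_def sum_list_map_minus_const)
  qed
  from difference_constraints_solvable[OF this] obtain x
    where "\<forall>(u, v)\<in>A. x u \<le> w (u, v) - e + x v" by blast
  then have "\<forall>(u, v)\<in>A. x u < w (u, v) + x v" using e_pos by fastforce
  then show ?thesis by blast
qed

section \<open>Weights of cycles in a partial orientation\<close>

lemma cycle_weight_eq_sum: "distinct c \<Longrightarrow> cycle_weight w c = sum w (cycle_arcs c)"
  unfolding cycle_weight_def cycle_arcs_eq
  by (rule sum_list_distinct_conv_sum_set) (simp add: distinct_zipI1)

text \<open>The heads of the arcs are a rotation of their tails, so the differences
  telescope.\<close>

lemma cycle_weight_potential_difference:
  fixes x :: "'v \<Rightarrow> 'a::ab_group_add"
  shows "cycle_weight (\<lambda>(u, v). x u - x v) c = 0"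
proof -
  have "sum_list (map (\<lambda>(u, v). x u - x v) ps)
      = sum_list (map x (map fst ps)) - sum_list (map x (map snd ps))" for ps
    by (induction ps) (auto simp: algebra_simps)
  then have "cycle_weight (\<lambda>(u, v). x u - x v) c
      = sum_list (map x (map fst (zip c (rotate1 c)))) - sum_list (map x (map snd (zip c (rotate1 c))))"
    unfolding cycle_weight_def .
  also have "\<dots> = sum_list (map x c) - sum_list (rotate1 (map x c))"
    by (simp add: rotate1_map)
  also have "\<dots> = 0" by (cases c) (auto simp: add.commute)
  finally show ?thesis .
qed

text \<open>If an arc and its reverse both occurred, going two steps along the cycle would return to
  the start, so the length would divide 2.\<close>

lemma cycle_arcs_asym:
  assumes "distinct c" "length c \<ge> 3" "(u, v) \<in> cycle_arcs c"
  shows "(v, u) \<notin> cycle_arcs c"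
proof
  let ?n = "length c"
  assume "(v, u) \<in> cycle_arcs c"
  then obtain j where j: "j < ?n" "v = c ! j" "u = c ! (Suc j mod ?n)"
    by (auto simp: cycle_arcs_def)
  obtain i where i: "i < ?n" "u = c ! i" "v = c ! (Suc i mod ?n)"
    using assms(3) by (auto simp: cycle_arcs_def)
  have "Suc i mod ?n = j" "Suc j mod ?n = i"
    using assms(1,2) i j by (metis nth_eq_iff_index_eq mod_less_divisor length_pos_if_in_set nth_mem)+
  then show False
    using assms(2) i(1) j(1) by (auto simp: mod_Suc split: if_splits)
qed

lemma cycle_edges_eq_image: "cycle_edges c = (\<lambda>(u, v). {u, v}) ` cycle_arcs c"
  by (auto simp: cycle_edges_def)

text \<open>Only the reverse arc has the same underlying edge, so edges of a cycle may be counted by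
  its arcs.\<close>

lemma inj_on_cycle_arcs:
  assumes "distinct c" "length c \<ge> 3"
  shows "inj_on (\<lambda>(u, v). {u, v}) (cycle_arcs c)"
proof (rule inj_onI, clarify)
  fix u v u' v' assume "(u, v) \<in> cycle_arcs c" "(u', v') \<in> cycle_arcs c" "{u, v} = {u', v'}"
  then show "u = u' \<and> v = v'"
    using cycle_arcs_asym[OF assms] by (auto simp: doubleton_eq_iff)
qed

section \<open>Potential cycles as directed cycles of allowed arcs\<close>

text \<open>The arcs a directed cycle may use once blank edges are directed freely: a blank edge
  contributes both directions.\<close>

definition allowed_arcs :: "'v set set \<Rightarrow> ('v \<times> 'v) set \<Rightarrow> ('v \<times> 'v) set" where
  "allowed_arcs E \<O> = \<O> \<union> {(u, v). {u, v} \<in> blank_edges E \<O>}"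

definition arc_weight :: "('v \<times> 'v) set \<Rightarrow> 'v \<times> 'v \<Rightarrow> real" where
  "arc_weight \<O> a = (if a \<in> \<O> then -1 else 1)"

lemma oriented_edges_iff:
  assumes "partial_orientation E \<O>"
  shows "{u, v} \<in> oriented_edges E \<O> \<longleftrightarrow> (u, v) \<in> \<O> \<or> (v, u) \<in> \<O>"
proof -
  have "{u, v} \<in> oriented_edges E \<O> \<longleftrightarrow> {u, v} \<in> E \<and> ((u, v) \<in> \<O> \<or> (v, u) \<in> \<O>)"
    by (auto simp: oriented_edges_def doubleton_eq_iff)
  moreover have "{u, v} \<in> E" if "(u, v) \<in> \<O> \<or> (v, u) \<in> \<O>"
    using that assms unfolding partial_orientation_def by (metis insert_commute)
  ultimately show ?thesis by blast
qed

lemma blank_edges_iff: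
  assumes "partial_orientation E \<O>"
  shows "{u, v} \<in> blank_edges E \<O> \<longleftrightarrow> {u, v} \<in> E \<and> (u, v) \<notin> \<O> \<and> (v, u) \<notin> \<O>"
  using oriented_edges_iff[OF assms] by (auto simp: blank_edges_def)

text \<open>Turns the counting condition on potential cycles into positivity of a cycle weight. Each
  edge of \<open>c\<close> comes from exactly one arc, which has weight -1 or 1 according to whether
  the edge is oriented or blank.\<close>

lemma sum_arc_weight:
  fixes c :: "'v::finite list"
  assumes po: "partial_orientation E \<O>" and c: "distinct c" "length c \<ge> 3"
    and sub: "cycle_arcs c \<subseteq> allowed_arcs E \<O>"
  shows "sum (arc_weight \<O>) (cycle_arcs c)
    = real (card (cycle_edges c \<inter> blank_edges E \<O>)) - real (card (cycle_edges c \<inter> oriented_edges E \<O>))"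
proof -
  let ?f = "\<lambda>(u, v). {u, v}"
  let ?C = "cycle_arcs c"
  have inj: "inj_on ?f S" if "S \<subseteq> ?C" for S
    using inj_on_cycle_arcs[OF c] that inj_on_subset by blast
  have "cycle_edges c \<inter> oriented_edges E \<O> = ?f ` (?C \<inter> \<O>)"
    using sub po oriented_edges_iff[OF po] blank_edges_iff[OF po]
    by (auto simp: cycle_edges_eq_image allowed_arcs_def)
  then have 1: "card (cycle_edges c \<inter> oriented_edges E \<O>) = card (?C \<inter> \<O>)"
    by (simp add: card_image inj)
  have "cycle_edges c \<inter> blank_edges E \<O> = ?f ` (?C - \<O>)"
    using sub po blank_edges_iff[OF po]
    by (auto simp: cycle_edges_eq_image allowed_arcs_def)
  then have 2: "card (cycle_edges c \<inter> blank_edges E \<O>) = card (?C - \<O>)"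
    by (simp add: card_image inj)
  have "sum (arc_weight \<O>) ?C = sum (arc_weight \<O>) (?C \<inter> \<O>) + sum (arc_weight \<O>) (?C - \<O>)"
    by (rule sum.Int_Diff) simp
  also have "sum (arc_weight \<O>) (?C \<inter> \<O>) = - real (card (?C \<inter> \<O>))"
    by (simp add: arc_weight_def)
  also have "sum (arc_weight \<O>) (?C - \<O>) = real (card (?C - \<O>))"
    by (simp add: arc_weight_def)
  finally show ?thesis using 1 2 by simp
qed

text \<open>Direct every blank edge the way \<open>c\<close> traverses it. An oriented edge cannot
  point against \<open>c\<close>, because the arc of \<open>c\<close> on that edge would not be
  allowed.\<close>

lemma allowed_cycle_is_potential:
  assumes po: "partial_orientation E \<O>" and c: "distinct c" "length c \<ge> 3"
    and sub: "cycle_arcs c \<subseteq> allowed_arcs E \<O>"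
  shows "potential_cycle E \<O> c"
proof -
  let ?D = "{(u, v) \<in> cycle_arcs c. {u, v} \<in> blank_edges E \<O>}"
  have edge_iff: "{u, v} \<in> cycle_edges c \<longleftrightarrow> (u, v) \<in> cycle_arcs c \<or> (v, u) \<in> cycle_arcs c" for u v
    by (auto simp: cycle_edges_def doubleton_eq_iff)
  note blank = blank_edges_iff[OF po]
  have "cycle_edges c \<subseteq> E"
    using sub po blank by (auto simp: cycle_edges_def allowed_arcs_def partial_orientation_def)
  then have "is_cycle E c" using c by (simp add: is_cycle_def)
  moreover have "directs (cycle_edges c \<inter> blank_edges E \<O>) ?D"
    using edge_iff cycle_arcs_asym[OF c] by (auto simp: directs_def insert_commute)
  moreover have "{(u, v) \<in> \<O>. {u, v} \<in> cycle_edges c} \<union> ?D = cycle_arcs c"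
  proof -
    have "(u, v) \<in> cycle_arcs c" if "(u, v) \<in> \<O>" "{u, v} \<in> cycle_edges c" for u v
    proof (rule ccontr)
      assume "(u, v) \<notin> cycle_arcs c"
      then have "(v, u) \<in> allowed_arcs E \<O>" using that edge_iff sub by blast
      then show False
        using that(1) po blank by (auto simp: allowed_arcs_def partial_orientation_def)
    qed
    then show ?thesis using sub by (auto simp: allowed_arcs_def edge_iff)
  qed
  ultimately show ?thesis unfolding potential_cycle_def by blast
qed

text \<open>Converse of the previous lemma. The list \<open>d\<close> is \<open>c\<close> or its
  reversal, whichever sense the directed cycle takes; equal edge sets make the edge counts carry
  over.\<close>

lemma potential_cycle_obtain_allowed:
  assumes po: "partial_orientation E \<O>" and "potential_cycle E \<O> c"
  obtains d where "distinct d" "length d \<ge> 3" "cycle_arcs d \<subseteq> allowed_arcs E \<O>"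
    "cycle_edges d = cycle_edges c"
proof -
  from assms(2) obtain D where cyc: "is_cycle E c"
    and D: "directs (cycle_edges c \<inter> blank_edges E \<O>) D"
    and eq: "{(u, v) \<in> \<O>. {u, v} \<in> cycle_edges c} \<union> D \<in> {cycle_arcs c, cycle_arcs (rev c)}"
    unfolding potential_cycle_def by blast
  define Z where "Z = {(u, v) \<in> \<O>. {u, v} \<in> cycle_edges c} \<union> D"
  obtain d where d: "d = c \<or> d = rev c" "Z = cycle_arcs d" using eq Z_def by auto
  have D1: "{u, v} \<in> cycle_edges c \<inter> blank_edges E \<O>" if "(u, v) \<in> D" for u v
    using D that unfolding directs_def by blast
  have D2: "(u, v) \<in> D \<or> (v, u) \<in> D" if "{u, v} \<in> cycle_edges c \<inter> blank_edges E \<O>" for u v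
    using D that unfolding directs_def by blast
  have allowed: "Z \<subseteq> allowed_arcs E \<O>"
    using D1 by (auto simp: Z_def allowed_arcs_def)
  \<comment> \<open>The edges under \<open>Z\<close> are exactly those of \<open>c\<close>: oriented
    ones come from \<open>\<O>\<close>, blank ones from \<open>D\<close>. The edges of
    \<open>rev c\<close> thus need no separate computation.\<close>
  have sub: "(\<lambda>(u, v). {u, v}) ` Z \<subseteq> cycle_edges c"
    using D1 by (auto simp: Z_def)
  have sup: "{u, v} \<in> (\<lambda>(u, v). {u, v}) ` Z" if e: "{u, v} \<in> cycle_edges c" for u v
  proof -
    have "{u, v} \<in> E" using e cyc by (auto simp: is_cycle_def)
    then have "(u, v) \<in> Z \<or> (v, u) \<in> Z"
      using e D2[of u v] blank_edges_iff[OF po, of u v] by (auto simp: Z_def insert_commute)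
    then show ?thesis by (force simp: insert_commute)
  qed
  have "cycle_edges c \<subseteq> (\<lambda>(u, v). {u, v}) ` Z"
    using sup unfolding cycle_edges_def by blast
  then have "cycle_edges d = cycle_edges c"
    using sub d(2) by (simp add: cycle_edges_eq_image[of d] subset_antisym)
  moreover have "distinct d" "length d \<ge> 3"
    using d(1) cyc by (auto simp: is_cycle_def)
  ultimately show thesis using that allowed d(2) by blast
qed

section \<open>The regions\<close>

text \<open>The bound on an absolute value splits into two one-sided bounds, one for each direction
  of the blank edge.\<close>

lemma rho_iff:
  assumes po: "partial_orientation E \<O>"
  shows "x \<in> rho E \<O> \<longleftrightarrow> (\<forall>(u, v)\<in>allowed_arcs E \<O>. x $ u - x $ v < arc_weight \<O> (u, v))"
    (is "_ \<longleftrightarrow> ?R")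
proof
  assume "x \<in> rho E \<O>"
  then show ?R
    using po blank_edges_iff[OF po]
    by (fastforce simp: rho_def allowed_arcs_def arc_weight_def partial_orientation_def abs_less_iff)
next
  assume R: ?R
  have "x $ j > x $ i + 1" if "(i, j) \<in> \<O>" for i j
    using R that by (force simp: allowed_arcs_def arc_weight_def)
  moreover have "\<bar>x $ i - x $ j\<bar> < 1" if b: "{i, j} \<in> blank_edges E \<O>" for i j
  proof -
    have "(i, j) \<in> allowed_arcs E \<O>" "(j, i) \<in> allowed_arcs E \<O>"
      using b by (auto simp: allowed_arcs_def insert_commute)
    moreover have "(i, j) \<notin> \<O>" "(j, i) \<notin> \<O>" using b blank_edges_iff[OF po] by blast+
    ultimately have "x $ i - x $ j < 1" "x $ j - x $ i < 1"
      using R by (fastforce simp: arc_weight_def)+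
    then show ?thesis by simp
  qed
  ultimately show "x \<in> rho E \<O>" by (simp add: rho_def)
qed

text \<open>By solvability of strict systems it suffices that allowed cycles have positive weight.
  From length 3 on this is the semiorientation condition; shorter closed lists are treated by
  hand.\<close>

lemma rho_nonempty:
  fixes E :: "'v::finite set set"
  assumes G: "simple_graph E" and so: "semiorientation E \<O>"
  shows "rho E \<O> \<noteq> {}"
proof -
  have po: "partial_orientation E \<O>" using so by (simp add: semiorientation_def)
  have irrefl: "(u, u) \<notin> allowed_arcs E \<O>" for u
  proof
    assume "(u, u) \<in> allowed_arcs E \<O>"
    then have "{u, u} \<in> E"
      using po by (auto simp: allowed_arcs_def partial_orientation_def blank_edges_def)
    then show False using G by (force simp: simple_graph_def)
  qed
  have "cycle_weight (arc_weight \<O>) c > 0"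
    if c: "c \<noteq> []" "distinct c" "cycle_arcs c \<subseteq> allowed_arcs E \<O>" for c
  proof (cases "length c \<ge> 3")
    case True
    have "card (cycle_edges c \<inter> blank_edges E \<O>) > card (cycle_edges c \<inter> oriented_edges E \<O>)"
      using allowed_cycle_is_potential[OF po c(2) True c(3)] so by (simp add: semiorientation_def)
    then show ?thesis
      using sum_arc_weight[OF po c(2) True c(3)] cycle_weight_eq_sum[OF c(2), of "arc_weight \<O>"] by simp
  next
    case False
    then consider u where "c = [u]" | u v where "c = [u, v]"
      using c(1) by (auto simp: not_le less_Suc_eq numeral_3_eq_3 length_Suc_conv)
    then show ?thesis
    proof cases
      case 1
      then show ?thesis using c(3) irrefl by (simp add: cycle_arcs_eq)
    next
      \<comment> \<open>Both directions are allowed only on a blank edge, so the weight is 1 +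
        1.\<close>
      case (2 u v)
      then have "(u, v) \<in> allowed_arcs E \<O>" "(v, u) \<in> allowed_arcs E \<O>"
        using c(3) by (auto simp: cycle_arcs_eq)
      then have "(u, v) \<notin> \<O>" "(v, u) \<notin> \<O>"
        using po blank_edges_iff[OF po] by (auto simp: allowed_arcs_def partial_orientation_def)
      then show ?thesis using 2 by (simp add: cycle_weight_def arc_weight_def)
    qed
  qed
  from strict_difference_constraints_solvable[OF this] obtain x
    where x: "\<forall>(u, v)\<in>allowed_arcs E \<O>. x u < arc_weight \<O> (u, v) + x v" by blast
  have "(\<chi> i. x i) \<in> rho E \<O>"
    unfolding rho_iff[OF po] using x by fastforce
  then show ?thesis by blast
qed

text \<open>All conditions are strict upper bounds on coordinate differences, an absolute value
  giving two of them, so the set is an intersection of open half-spaces.\<close>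

lemma rho_convex: "convex (rho E \<O>)"
proof (rule convexI)
  fix x y :: "real ^ 'a" and s t :: real
  assume xy: "x \<in> rho E \<O>" "y \<in> rho E \<O>" and st: "s \<ge> 0" "t \<ge> 0" "s + t = 1"
  have lt: "s * (x $ i - x $ j) + t * (y $ i - y $ j) < a"
    if "x $ i - x $ j < a" "y $ i - y $ j < a" for i j a
    using convex_bound_lt[OF that st] .
  show "s *\<^sub>R x + t *\<^sub>R y \<in> rho E \<O>"
    unfolding rho_def
  proof (intro CollectI allI impI conjI)
    fix i j assume "{i, j} \<in> E" "(i, j) \<in> \<O>"
    then have "x $ i - x $ j < -1" "y $ i - y $ j < -1" using xy by (force simp: rho_def)+
    from lt[OF this] show "(s *\<^sub>R x + t *\<^sub>R y) $ i + 1 < (s *\<^sub>R x + t *\<^sub>R y) $ j"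
      by (simp add: algebra_simps)
  next
    fix i j assume "{i, j} \<in> E" "{i, j} \<in> blank_edges E \<O>"
    then have "\<bar>x $ i - x $ j\<bar> < 1" "\<bar>y $ i - y $ j\<bar> < 1" using xy by (force simp: rho_def)+
    then have "x $ i - x $ j < 1" "y $ i - y $ j < 1" "x $ j - x $ i < 1" "y $ j - y $ i < 1"
      by (auto simp: abs_less_iff)
    from lt[OF this(1,2)] lt[OF this(3,4)]
    show "\<bar>(s *\<^sub>R x + t *\<^sub>R y) $ i - (s *\<^sub>R x + t *\<^sub>R y) $ j\<bar> < 1"
      by (simp add: algebra_simps abs_less_iff)
  qed
qed

section \<open>The orientation determined by a point\<close>

definition point_orientation :: "'v set set \<Rightarrow> real ^ 'v \<Rightarrow> ('v \<times> 'v) set" where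
  "point_orientation E x = {(i, j). {i, j} \<in> E \<and> x $ j > x $ i + 1}"

lemma point_orientation_partial: "partial_orientation E (point_orientation E x)"
  by (auto simp: partial_orientation_def point_orientation_def)

text \<open>A single point recovers the orientation, so the sets \<open>rho E \<O>\<close> for
  distinct partial orientations are disjoint. Injectivity of \<open>rho\<close> rests on
  this.\<close>

lemma orientation_eq_point_orientation:
  assumes po: "partial_orientation E \<O>" and x: "x \<in> rho E \<O>"
  shows "\<O> = point_orientation E x"
proof -
  have "(i, j) \<in> \<O>" if e: "{i, j} \<in> E" and gt: "x $ j > x $ i + 1" for i j
  proof (rule ccontr)
    assume n: "(i, j) \<notin> \<O>"
    have "(j, i) \<notin> \<O>" using x e gt by (force simp: rho_def insert_commute)
    then have "{i, j} \<in> blank_edges E \<O>" using n e blank_edges_iff[OF po] by blast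
    then have "\<bar>x $ i - x $ j\<bar> < 1" using x e by (simp add: rho_def)
    then show False using gt by simp
  qed
  moreover have "{i, j} \<in> E \<and> x $ j > x $ i + 1" if "(i, j) \<in> \<O>" for i j
    using that po x unfolding partial_orientation_def rho_def by blast
  ultimately show ?thesis unfolding point_orientation_def by blast
qed

lemma simple_graph_no_loop: "simple_graph E \<Longrightarrow> {i, j} \<in> E \<Longrightarrow> i \<noteq> j"
  by (force simp: simple_graph_def)

lemma off_hyperplanes_iff:
  assumes "simple_graph E"
  shows "x \<in> UNIV - \<Union>(semiorder_arrangement E) \<longleftrightarrow> (\<forall>i j. {i, j} \<in> E \<longrightarrow> x $ i - x $ j \<noteq> 1)"
proof -
  have "x \<in> \<Union>(semiorder_arrangement E) \<longleftrightarrow> (\<exists>i j. i \<noteq> j \<and> {i, j} \<in> E \<and> x $ i - x $ j = 1)"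
    unfolding semiorder_arrangement_def by auto
  then show ?thesis using simple_graph_no_loop[OF assms] by (metis DiffE DiffI UNIV_I)
qed

lemma mem_rho_point_orientation:
  assumes "simple_graph E" and "x \<in> UNIV - \<Union>(semiorder_arrangement E)"
  shows "x \<in> rho E (point_orientation E x)"
proof -
  have ne: "x $ i - x $ j \<noteq> 1" if "{i, j} \<in> E" for i j
    using assms(2) that unfolding off_hyperplanes_iff[OF assms(1)] by blast
  \<comment> \<open>Blankness gives only a difference of absolute value at most 1; the two
    hyperplanes of the edge exclude 1 and -1.\<close>
  have "\<bar>x $ i - x $ j\<bar> < 1" if "{i, j} \<in> blank_edges E (point_orientation E x)" for i j
    using that ne[of i j] ne[of j i] blank_edges_iff[OF point_orientation_partial, of i j E x]
    by (auto simp: point_orientation_def insert_commute abs_less_iff)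
  then show ?thesis by (simp add: rho_def point_orientation_def)
qed

text \<open>Summing the strict constraints at \<open>x\<close> around a potential cycle makes the
  left sides cancel, so 0 is less than the number of blank edges minus the number of oriented
  ones.\<close>

lemma semiorientation_if_rho_nonempty:
  fixes E :: "'v::finite set set"
  assumes po: "partial_orientation E \<O>" and x: "x \<in> rho E \<O>"
  shows "semiorientation E \<O>"
  unfolding semiorientation_def
proof (intro conjI allI impI po)
  fix c assume "potential_cycle E \<O> c"
  from potential_cycle_obtain_allowed[OF po this] obtain d
    where d: "distinct d" "length d \<ge> 3" "cycle_arcs d \<subseteq> allowed_arcs E \<O>"
      and edges: "cycle_edges d = cycle_edges c" by blast
  have "0 = sum (\<lambda>(u, v). x $ u - x $ v) (cycle_arcs d)"
    using cycle_weight_potential_difference[of "\<lambda>u. x $ u" d] cycle_weight_eq_sum[OF d(1), of "\<lambda>(u, v). x $ u - x $ v"]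
    by simp
  also have "\<dots> < sum (arc_weight \<O>) (cycle_arcs d)"
  proof (rule sum_strict_mono)
    show "cycle_arcs d \<noteq> {}" using d(2) by (cases d) (auto simp: cycle_arcs_eq)
    show "(case a of (u, v) \<Rightarrow> x $ u - x $ v) < arc_weight \<O> a" if "a \<in> cycle_arcs d" for a
      using x d(3) that unfolding rho_iff[OF po] by fastforce
  qed simp
  finally show "card (cycle_edges c \<inter> oriented_edges E \<O>) < card (cycle_edges c \<inter> blank_edges E \<O>)"
    using sum_arc_weight[OF po d] edges by simp
qed

section \<open>Connected components of the complement\<close>

lemma connected_same_side:
  fixes f :: "'a::topological_space \<Rightarrow> real"
  assumes "connected S" "continuous_on S f" "a \<notin> f ` S" "x \<in> S" "y \<in> S"
  shows "f x < a \<longleftrightarrow> f y < a"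
proof -
  have "connected (f ` S)" using assms(1,2) connected_continuous_image by blast
  then have "a \<in> f ` S" if "f u \<le> a" "a \<le> f v" "u \<in> S" "v \<in> S" for u v
    using that unfolding connected_iff_interval by blast
  then show ?thesis using assms(3-5) by (metis linorder_not_less less_imp_le)
qed

text \<open>The set \<open>rho E \<O>\<close> is convex and avoids the hyperplanes, so it lies in
  the component of \<open>x\<close>. Conversely, no coordinate difference along an edge crosses 1
  within that component, so \<open>point_orientation E\<close> is constant there.\<close>

lemma rho_component:
  fixes E :: "'v::finite set set"
  assumes G: "simple_graph E" and po: "partial_orientation E \<O>" and x: "x \<in> rho E \<O>"
  shows "connected_component_set (UNIV - \<Union>(semiorder_arrangement E)) x = rho E \<O>"
    (is "connected_component_set ?U x = _")
proof
  have "y $ i - y $ j \<noteq> 1" if y: "y \<in> rho E \<O>" and e: "{i, j} \<in> E" for y i j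
  proof -
    have e': "{j, i} \<in> E" using e by (simp add: insert_commute)
    consider "(i, j) \<in> \<O>" | "(j, i) \<in> \<O>" | "{i, j} \<in> blank_edges E \<O>"
      using e blank_edges_iff[OF po, of i j] by blast
    then show ?thesis
    proof cases
      case 1
      then have "y $ j > y $ i + 1" using y e unfolding rho_def by blast
      then show ?thesis by simp
    next
      case 2
      then have "y $ i > y $ j + 1" using y e' unfolding rho_def by blast
      then show ?thesis by simp
    next
      case 3
      then have "\<bar>y $ i - y $ j\<bar> < 1" using y e unfolding rho_def by blast
      then show ?thesis by simp
    qed
  qed
  then have sub: "rho E \<O> \<subseteq> ?U"
    unfolding subset_iff off_hyperplanes_iff[OF G] by blast
  show "rho E \<O> \<subseteq> connected_component_set ?U x"
    using x convex_connected[OF rho_convex] sub by (rule connected_component_maximal)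
  show "connected_component_set ?U x \<subseteq> rho E \<O>"
  proof
    fix y assume y: "y \<in> connected_component_set ?U x"
    let ?S = "connected_component_set ?U x"
    have S: "?S \<subseteq> ?U" by (rule connected_component_subset)
    have xS: "x \<in> ?S" using sub x by (simp add: connected_component_refl subset_iff)
    have "x $ i - x $ j < 1 \<longleftrightarrow> y $ i - y $ j < 1" if "{i, j} \<in> E" for i j
    proof (rule connected_same_side[of ?S "\<lambda>z. z $ i - z $ j"])
      have "z $ i - z $ j \<noteq> 1" if "z \<in> ?S" for z
        using S that \<open>{i, j} \<in> E\<close> off_hyperplanes_iff[OF G, of z] by blast
      then show "1 \<notin> (\<lambda>z. z $ i - z $ j) ` ?S" by force
      show "continuous_on ?S (\<lambda>z. z $ i - z $ j)" by (intro continuous_intros)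
    qed (fact xS y connected_connected_component)+
    moreover have "x $ i - x $ j \<noteq> 1 \<and> y $ i - y $ j \<noteq> 1" if "{i, j} \<in> E" for i j
      using S xS y that off_hyperplanes_iff[OF G, of x] off_hyperplanes_iff[OF G, of y] by blast
    \<comment> \<open>Since the value 1 is excluded, agreement on lying below 1 is also agreement on
      lying above 1.\<close>
    ultimately have "x $ i > x $ j + 1 \<longleftrightarrow> y $ i > y $ j + 1" if "{j, i} \<in> E" for i j
      using that by (smt (verit) insert_commute)
    then have "point_orientation E x = point_orientation E y"
      unfolding point_orientation_def by blast
    then have "\<O> = point_orientation E y"
      using orientation_eq_point_orientation[OF po x] by simp
    then show "y \<in> rho E \<O>" using mem_rho_point_orientation[OF G] S y by blast
  qed
qed

theorem theorem3p4:
  fixes E :: "'v::finite set set"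
  assumes "simple_graph E" and "connected_graph E"
  shows "(\<forall>\<O>. semiorientation E \<O> \<longrightarrow>
            rho E \<O> \<noteq> {} \<and> rho E \<O> \<in> regions (semiorder_arrangement E)) \<and>
         bij_betw (rho E) {\<O>. semiorientation E \<O>} (regions (semiorder_arrangement E))"
proof -
  let ?U = "UNIV - \<Union>(semiorder_arrangement E)"
  have po: "partial_orientation E \<O>" if "semiorientation E \<O>" for \<O>
    using that by (simp add: semiorientation_def)
  have region: "rho E \<O> \<in> regions (semiorder_arrangement E)" if so: "semiorientation E \<O>" for \<O>
  proof -
    obtain x where x: "x \<in> rho E \<O>" using rho_nonempty[OF assms(1) so] by blast
    note comp = rho_component[OF assms(1) po[OF so] x]
    have "x \<in> ?U" using x comp connected_component_subset by blast
    then show ?thesis unfolding regions_def components_def using comp by blast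
  qed
  have inj: "inj_on (rho E) {\<O>. semiorientation E \<O>}"
  proof (rule inj_onI, clarify)
    fix \<O> \<O>' assume so: "semiorientation E \<O>" "semiorientation E \<O>'" and eq: "rho E \<O> = rho E \<O>'"
    obtain x where "x \<in> rho E \<O>" using rho_nonempty[OF assms(1) so(1)] by blast
    then show "\<O> = \<O>'"
      using orientation_eq_point_orientation po so eq by metis
  qed
  \<comment> \<open>Surjectivity: any point of a region yields the orientation, and that point
    itself witnesses that it is a semiorientation.\<close>
  have "R \<in> rho E ` {\<O>. semiorientation E \<O>}" if R: "R \<in> regions (semiorder_arrangement E)" for R
  proof -
    obtain x where x: "x \<in> ?U" "R = connected_component_set ?U x"
      using R by (auto simp: regions_def components_def)
    have mem: "x \<in> rho E (point_orientation E x)"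
      using mem_rho_point_orientation[OF assms(1) x(1)] .
    have "R = rho E (point_orientation E x)"
      using rho_component[OF assms(1) point_orientation_partial mem] x(2) by simp
    then show ?thesis
      using semiorientation_if_rho_nonempty[OF point_orientation_partial mem] by blast
  qed
  then have "rho E ` {\<O>. semiorientation E \<O>} = regions (semiorder_arrangement E)"
    using region by blast
  then show ?thesis
    using inj region rho_nonempty[OF assms(1)] by (simp add: bij_betw_def)
qed

end
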